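(* Let $(W,I,\Omega)$ be a complex-regularized polysymplectic manifold and let $\psi_\nu:W\to W$ be a sequence of diffeomorphisms preserving $\Omega$ (i.e. $\psi_\nu^*\Omega=\Omega$). Assume that the $\psi_\nu$ converge to a diffeomorphism $\psi:W\to W$ in the $C^0$-topology. Then $\psi^*\Omega=\Omega$.
   Context: Let $\partial_1,\partial_2$ be the standard basis of $\mathbb{R}^2$. An $\mathbb{R}^2$-valued 2-form $\Omega=\omega_1\otimes\partial_1+\omega_2\otimes\partial_2$ on a manifold $W$ is polysymplectic if it is closed and non-degenerate: $\Omega(X,\cdot)=0$ implies $X=0$ for all $X\in TW$. A complex-regularized polysymplectic manifold $(W,I,\Omega)$ is a complex manifold $(W,I)$ with a polysymplectic form $\Omega=\omega_1\otimes\partial_1+\omega_2\otimes\partial_2$ such that $\omega_2=-\omega_1(\cdot,I\cdot)$. Pullback of $\Omega$ is taken componentwise. *)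

theory Defs
  imports "HOL-Analysis.Analysis"
begin

section \<open>Smooth and holomorphic maps between open subsets of vector spaces\<close>

text \<open>Meant for open sets: derivatives are full Frechet derivatives.\<close>

primrec Ck_on :: "nat \<Rightarrow> 'a::real_normed_vector set \<Rightarrow> ('a \<Rightarrow> 'b::real_normed_vector) \<Rightarrow> bool" where
  "Ck_on 0 S f \<longleftrightarrow> continuous_on S f"
| "Ck_on (Suc k) S f \<longleftrightarrow>
     (\<forall>x\<in>S. f differentiable (at x)) \<and> (\<forall>v. Ck_on k S (\<lambda>x. frechet_derivative f (at x) v))"

definition smooth_on :: "'a::real_normed_vector set \<Rightarrow> ('a \<Rightarrow> 'b::real_normed_vector) \<Rightarrow> bool" where
  "smooth_on S f \<longleftrightarrow> (\<forall>k. Ck_on k S f)"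

definition holomorphic_map_on ::
    "(complex^'n) set \<Rightarrow> (complex^'n \<Rightarrow> complex^'m) \<Rightarrow> bool" where
  "holomorphic_map_on S f \<longleftrightarrow>
     (\<forall>z\<in>S. \<exists>D. (f has_derivative D) (at z) \<and> (\<forall>a v. D (a *s v) = a *s D v))"

section \<open>Atlases\<close>

text \<open>A chart is a pair of its domain and its coordinate map into the model space; the coordinate
  map has no meaning off the domain. The underlying space of the manifold is the whole
  type \<open>'w\<close>, with the topology of its type class. Atlases need not be maximal.\<close>

type_synonym ('w, 'e) chart = "'w set \<times> ('w \<Rightarrow> 'e)"

abbreviation chart_dom :: "('w, 'e) chart \<Rightarrow> 'w set" where
  "chart_dom c \<equiv> fst c"

abbreviation chart_map :: "('w, 'e) chart \<Rightarrow> 'w \<Rightarrow> 'e" where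
  "chart_map c \<equiv> snd c"

definition chart_inv :: "('w, 'e) chart \<Rightarrow> 'e \<Rightarrow> 'w" where
  "chart_inv c = inv_into (chart_dom c) (chart_map c)"

definition is_chart :: "('w::topological_space, 'e::euclidean_space) chart \<Rightarrow> bool" where
  "is_chart c \<longleftrightarrow> open (chart_dom c) \<and> open (chart_map c ` chart_dom c) \<and>
     homeomorphism (chart_dom c) (chart_map c ` chart_dom c) (chart_map c) (chart_inv c)"

definition charts_at :: "('w, 'e) chart set \<Rightarrow> 'w \<Rightarrow> ('w, 'e) chart set" where
  "charts_at A p = {c \<in> A. p \<in> chart_dom c}"

definition is_atlas :: "('w::topological_space, 'e::euclidean_space) chart set \<Rightarrow> bool" where
  "is_atlas A \<longleftrightarrow> (\<forall>c\<in>A. is_chart c) \<and> (\<Union>c\<in>A. chart_dom c) = UNIV"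

definition transition :: "('w, 'e) chart \<Rightarrow> ('w, 'e) chart \<Rightarrow> 'e \<Rightarrow> 'e" where
  "transition c d = chart_map d \<circ> chart_inv c"

text \<open>Holomorphic transition maps are smooth, so a complex manifold is in particular a smooth
  manifold and the notions below apply to it.\<close>

definition complex_manifold ::
    "('w::{t2_space, second_countable_topology}, complex^'n) chart set \<Rightarrow> bool" where
  "complex_manifold A \<longleftrightarrow> is_atlas A \<and>
     (\<forall>c\<in>A. \<forall>d\<in>A. holomorphic_map_on (chart_map c ` (chart_dom c \<inter> chart_dom d)) (transition c d))"

section \<open>Smooth maps, tangent vectors and 2-forms\<close>

definition smooth_map ::
    "('w::topological_space, 'e::euclidean_space) chart set \<Rightarrow> ('w \<Rightarrow> 'w) \<Rightarrow> bool" where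
  "smooth_map A f \<longleftrightarrow> continuous_on UNIV f \<and>
     (\<forall>c\<in>A. \<forall>d\<in>A. smooth_on (chart_map c ` (chart_dom c \<inter> f -` chart_dom d))
        (chart_map d \<circ> f \<circ> chart_inv c))"

definition diffeomorphism ::
    "('w::topological_space, 'e::euclidean_space) chart set \<Rightarrow> ('w \<Rightarrow> 'w) \<Rightarrow> bool" where
  "diffeomorphism A f \<longleftrightarrow> bij f \<and> smooth_map A f \<and> smooth_map A (inv f)"

text \<open>A tangent vector at \<open>p\<close> is the family of its coordinate vectors in all charts around \<open>p\<close>,
  related by the derivatives of the transition maps, and extended by zero to all other charts.
  The vector space operations are pointwise.\<close>

type_synonym ('w, 'e) tangent = "('w, 'e) chart \<Rightarrow> 'e"

definition tangent_space ::
    "('w, 'e::euclidean_space) chart set \<Rightarrow> 'w \<Rightarrow> ('w, 'e) tangent set" where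
  "tangent_space A p = {X.
     (\<forall>c\<in>charts_at A p. \<forall>d\<in>charts_at A p.
        X d = frechet_derivative (transition c d) (at (chart_map c p)) (X c)) \<and>
     (\<forall>c. c \<notin> charts_at A p \<longrightarrow> X c = 0)}"

text \<open>The tangent vector at \<open>p\<close> with coordinate vector \<open>u\<close> in the chart \<open>c\<close> around \<open>p\<close>.\<close>

definition tangent_of ::
    "('w, 'e::euclidean_space) chart set \<Rightarrow> 'w \<Rightarrow> ('w, 'e) chart \<Rightarrow> 'e \<Rightarrow> ('w, 'e) tangent" where
  "tangent_of A p c u = (\<lambda>d. if d \<in> charts_at A p
     then frechet_derivative (transition c d) (at (chart_map c p)) u else 0)"

text \<open>The differential at \<open>p\<close>. By the chain rule, it does not depend on the choice of the chart \<open>c\<close>.\<close>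

definition differential ::
    "('w, 'e::euclidean_space) chart set \<Rightarrow> ('w \<Rightarrow> 'w) \<Rightarrow> 'w \<Rightarrow> ('w, 'e) tangent \<Rightarrow> ('w, 'e) tangent" where
  "differential A f p X = (let c = (SOME c. c \<in> charts_at A p) in
     (\<lambda>d. if d \<in> charts_at A (f p)
          then frechet_derivative (chart_map d \<circ> f \<circ> chart_inv c) (at (chart_map c p)) (X c)
          else 0))"

text \<open>Forms with values in a vector space \<open>'v\<close>. They are set to zero on arguments that are not
  tangent vectors at the given point, so that equality of forms is equality of functions.\<close>

type_synonym ('w, 'e, 'v) form2 = "'w \<Rightarrow> ('w, 'e) tangent \<Rightarrow> ('w, 'e) tangent \<Rightarrow> 'v"

definition local_form ::
    "('w, 'e::euclidean_space) chart set \<Rightarrow> ('w, 'e, 'v) form2 \<Rightarrow> ('w, 'e) chart \<Rightarrow> 'e \<Rightarrow> 'e \<Rightarrow> 'e \<Rightarrow> 'v" where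
  "local_form A \<omega> c z u v =
     \<omega> (chart_inv c z) (tangent_of A (chart_inv c z) c u) (tangent_of A (chart_inv c z) c v)"

definition two_form ::
    "('w, 'e::euclidean_space) chart set \<Rightarrow> ('w, 'e, 'v::real_normed_vector) form2 \<Rightarrow> bool" where
  "two_form A \<omega> \<longleftrightarrow>
     (\<forall>p X Y. X \<notin> tangent_space A p \<or> Y \<notin> tangent_space A p \<longrightarrow> \<omega> p X Y = 0) \<and>
     (\<forall>p. \<forall>X\<in>tangent_space A p. \<forall>Y\<in>tangent_space A p. \<forall>Z\<in>tangent_space A p. \<forall>a.
        \<omega> p (\<lambda>c. X c + Y c) Z = \<omega> p X Z + \<omega> p Y Z \<and>
        \<omega> p (\<lambda>c. a *\<^sub>R X c) Z = a *\<^sub>R \<omega> p X Z \<and>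
        \<omega> p Y X = - \<omega> p X Y) \<and>
     (\<forall>c\<in>A. \<forall>u v. smooth_on (chart_map c ` chart_dom c) (\<lambda>z. local_form A \<omega> c z u v))"

text \<open>The exterior derivative in a chart, evaluated on constant coordinate vector fields (whose Lie
  brackets vanish).\<close>

definition local_exterior_derivative ::
    "('w, 'e::euclidean_space) chart set \<Rightarrow> ('w, 'e, 'v::real_normed_vector) form2 \<Rightarrow>
     ('w, 'e) chart \<Rightarrow> 'e \<Rightarrow> 'e \<Rightarrow> 'e \<Rightarrow> 'e \<Rightarrow> 'v" where
  "local_exterior_derivative A \<omega> c z u v w =
     frechet_derivative (\<lambda>x. local_form A \<omega> c x v w) (at z) u
   - frechet_derivative (\<lambda>x. local_form A \<omega> c x u w) (at z) v
   + frechet_derivative (\<lambda>x. local_form A \<omega> c x u v) (at z) w"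

definition closed_form ::
    "('w, 'e::euclidean_space) chart set \<Rightarrow> ('w, 'e, 'v::real_normed_vector) form2 \<Rightarrow> bool" where
  "closed_form A \<omega> \<longleftrightarrow>
     (\<forall>c\<in>A. \<forall>z\<in>chart_map c ` chart_dom c. \<forall>u v w. local_exterior_derivative A \<omega> c z u v w = 0)"

definition pullback ::
    "('w, 'e::euclidean_space) chart set \<Rightarrow> ('w \<Rightarrow> 'w) \<Rightarrow> ('w, 'e, 'v::zero) form2 \<Rightarrow>
     ('w, 'e, 'v) form2" where
  "pullback A f \<omega> = (\<lambda>p X Y. if X \<in> tangent_space A p \<and> Y \<in> tangent_space A p
     then \<omega> (f p) (differential A f p X) (differential A f p Y) else 0)"

section \<open>Polysymplectic forms\<close>

text \<open>For \<open>\<Omega> = \<omega>\<^sub>1 \<otimes> \<partial>\<^sub>1 + \<omega>\<^sub>2 \<otimes> \<partial>\<^sub>2\<close>, the form \<open>\<omega>\<^sub>k\<close> is the \<open>k\<close>-th coordinate of \<open>\<Omega>\<close>. In the index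
  type \<open>2\<close> the two elements are \<open>1\<close> and \<open>2\<close> (which is the same as \<open>0\<close>).\<close>

definition form_component :: "2 \<Rightarrow> ('w, 'e, real^2) form2 \<Rightarrow> ('w, 'e, real) form2" where
  "form_component k \<Omega> = (\<lambda>p X Y. \<Omega> p X Y $ k)"

definition poly_pullback ::
    "('w, 'e::euclidean_space) chart set \<Rightarrow> ('w \<Rightarrow> 'w) \<Rightarrow> ('w, 'e, real^2) form2 \<Rightarrow>
     ('w, 'e, real^2) form2" where
  "poly_pullback A f \<Omega> = (\<lambda>p X Y. \<chi> k. pullback A f (form_component k \<Omega>) p X Y)"

definition polysymplectic ::
    "('w, 'e::euclidean_space) chart set \<Rightarrow> ('w, 'e, real^2) form2 \<Rightarrow> bool" where
  "polysymplectic A \<Omega> \<longleftrightarrow> two_form A \<Omega> \<and> closed_form A \<Omega> \<and>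
     (\<forall>p. \<forall>X\<in>tangent_space A p. (\<forall>Y\<in>tangent_space A p. \<Omega> p X Y = 0) \<longrightarrow> X = (\<lambda>c. 0))"

text \<open>The complex structure \<open>I\<close> of a complex manifold. It is multiplication by the imaginary unit in
  every chart; this maps tangent vectors to tangent vectors because the derivatives of the
  transition maps are complex linear.\<close>

definition complex_structure :: "('w, complex^'n) tangent \<Rightarrow> ('w, complex^'n) tangent" where
  "complex_structure X = (\<lambda>c. \<i> *s X c)"

definition complex_regularized_polysymplectic ::
    "('w::{t2_space, second_countable_topology}, complex^'n) chart set \<Rightarrow>
     ('w, complex^'n, real^2) form2 \<Rightarrow> bool" where
  "complex_regularized_polysymplectic A \<Omega> \<longleftrightarrow> complex_manifold A \<and> polysymplectic A \<Omega> \<and>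
     (\<forall>p. \<forall>X\<in>tangent_space A p. \<forall>Y\<in>tangent_space A p.
        form_component 2 \<Omega> p X Y = - form_component 1 \<Omega> p X (complex_structure Y))"

section \<open>The \<open>C\<^sup>0\<close>-topology\<close>

text \<open>The compact-open topology on the set of continuous maps (take \<open>K = {}\<close> for the whole space),
  that is, uniform convergence on compact sets when the target is metrized.\<close>

definition C0_topology :: "('a::topological_space \<Rightarrow> 'b::topological_space) topology" where
  "C0_topology = topology_generated_by
     {{f. continuous_on UNIV f \<and> f ` K \<subseteq> U} | K U. compact K \<and> open U}"

end

theory Submission
  imports Defs "HOL-Complex_Analysis.Cauchy_Integral_Formula"
begin

text \<open>For a single symplectic form, \<open>C\<^sup>0\<close>-closedness of the symplectomorphisms is the
  Gromov--Eliashberg theorem. Here the second component makes the situation rigid. From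
  \<open>\<omega>\<^sub>2 = - \<omega>\<^sub>1(\<cdot>, I\<cdot>)\<close> and the non-degeneracy of \<open>\<Omega>\<close> it follows that \<open>\<omega>\<^sub>1\<close> is
  non-degenerate by itself: a vector in its kernel is also in the kernel of \<open>\<omega>\<^sub>2\<close>. Hence \<open>I\<close> is
  determined by the pair \<open>\<omega>\<^sub>1, \<omega>\<^sub>2\<close>, and a diffeomorphism that preserves \<open>\<Omega>\<close> preserves \<open>I\<close>, that is,
  it is holomorphic (\<open>preserving_map_complex_linear\<close>, which rests on the linear algebra of
  \<open>preserves_polysymplectic_imp_complex_linear\<close>).

  Around a point \<open>p\<close>, in a chart at \<open>p\<close> and a chart at \<open>\<psi> p\<close>, the coordinate expressions of the
  \<open>\<psi>\<^sub>\<nu>\<close> are thus holomorphic on a fixed ball for large \<open>\<nu>\<close>, and \<open>C\<^sup>0\<close>-convergence makes them converge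
  uniformly there (\<open>C0_limit_uniform\<close>). By Weierstrass' theorem their derivatives converge to
  that of \<open>\<psi>\<close> (\<open>holomorphic_limit_derivative\<close>). Since the coefficients of \<open>\<Omega>\<close> are continuous
  (\<open>local_form_tendsto\<close>), the values of \<open>\<psi>\<^sub>\<nu>\<^sup>*\<Omega>\<close>, all equal to those of \<open>\<Omega>\<close>, converge to the values
  of \<open>\<psi>\<^sup>*\<Omega>\<close>.\<close>

section \<open>Complex linear maps and limits of holomorphic maps\<close>

lemma linear_vector_scalar_mult_left: "linear (\<lambda>t. t *s (v::complex^'n))"
  by (rule linearI) (simp_all add: vec_eq_iff algebra_simps)

lemma complex_linear_if_commutes_with_i:
  fixes D :: "complex^'n \<Rightarrow> complex^'m"
  assumes "linear D" and i: "\<And>v. D (\<i> *s v) = \<i> *s D v"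
  shows "D (a *s v) = a *s D v"
proof -
  have split: "a *s w = Re a *\<^sub>R w + Im a *\<^sub>R (\<i> *s w)" for w :: "complex^'k"
    by (simp add: vec_eq_iff complex_eq_iff)
  show ?thesis
    unfolding split[of v] split[of "D v"]
    by (simp add: linear_add[OF \<open>linear D\<close>] linear_cmul[OF \<open>linear D\<close>] i)
qed

text \<open>The second component recovers the complex structure from the first: since
  \<open>\<omega>\<^sub>1(u, \<i>v) = - \<omega>\<^sub>2(u, v)\<close> and \<open>\<omega>\<^sub>1\<close> alone is already non-degenerate, multiplication by \<open>\<i>\<close> is the
  only endomorphism relating \<open>\<omega>\<^sub>1\<close> to \<open>\<omega>\<^sub>2\<close> in this way. A linear map preserving both must
  therefore preserve \<open>\<i>\<close>; it is onto because non-degeneracy of the pulled back form makes it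
  injective.\<close>

lemma preserves_polysymplectic_imp_complex_linear:
  fixes B B' :: "complex^'n \<Rightarrow> complex^'n \<Rightarrow> real^2" and D :: "complex^'n \<Rightarrow> complex^'n"
  assumes B: "bilinear B'"
    and anti: "\<And>u v. B v u = - B u v" "\<And>u v. B' v u = - B' u v"
    and reg: "\<And>u v. B u v $ 2 = - B u (\<i> *s v) $ 1" "\<And>u v. B' u v $ 2 = - B' u (\<i> *s v) $ 1"
    and nondeg: "\<And>u. (\<And>v. B u v = 0) \<Longrightarrow> u = 0" "\<And>u. (\<And>v. B' u v = 0) \<Longrightarrow> u = 0"
    and D: "linear D" and pres: "\<And>u v. B' (D u) (D v) = B u v"
  shows "D (a *s v) = a *s D v"
proof (rule complex_linear_if_commutes_with_i[OF D])
  fix u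
  have swap: "B (\<i> *s u) v $ 1 = B u (\<i> *s v) $ 1" for u v
    using anti(1)[of u v] reg(1)[of u v] reg(1)[of v u] anti(1)[of v "\<i> *s u"] by simp
  have swap': "B' (\<i> *s u) v $ 1 = B' u (\<i> *s v) $ 1" for u v
    using anti(2)[of u v] reg(2)[of u v] reg(2)[of v u] anti(2)[of v "\<i> *s u"] by simp
  have "u = 0" if "D u = 0" for u
    by (rule nondeg(1)) (metis pres that B bilinear_lzero)
  then have "surj D"
    by (intro linear_injective_imp_surjective[OF D])
       (auto simp: linear_injective_0[OF D])
  \<comment> \<open>The defect of complex linearity lies in the kernel of \<open>B'\<close>.\<close>
  define Z where "Z = D (\<i> *s u) - \<i> *s D u"
  have Z1: "B' Z w $ 1 = 0" for w
  proof -
    obtain v where w: "w = D v" using \<open>surj D\<close> by (metis surjD)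
    have "B' (D (\<i> *s u)) w $ 1 = - B u v $ 2"
      by (simp add: w pres swap reg)
    also have "\<dots> = - B' (D u) w $ 2" by (simp add: w pres)
    also have "\<dots> = B' (\<i> *s D u) w $ 1" by (simp add: reg swap')
    finally show ?thesis by (simp add: Z_def bilinear_lsub[OF B])
  qed
  have "B' Z w = 0" for w
    using Z1 by (simp add: vec_eq_iff forall_2 reg)
  then show "D (\<i> *s u) = \<i> *s D u"
    using nondeg(2)[of Z] by (simp add: Z_def)
qed

text \<open>Weierstrass' theorem in several variables: the directional derivative along \<open>v\<close> is an
  ordinary complex derivative on the complex line through \<open>z\<^sub>0\<close> spanned by \<open>v\<close>, so that the
  one-variable theorem applies to each component.\<close>

lemma holomorphic_limit_derivative:
  fixes f :: "'i \<Rightarrow> complex^'n \<Rightarrow> complex^'m"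
  assumes "0 < r"
    and hol: "\<forall>\<^sub>F \<nu> in F. \<forall>z\<in>cball z0 r. (f \<nu> has_derivative D \<nu> z) (at z) \<and>
                 (\<forall>a v. D \<nu> z (a *s v) = a *s D \<nu> z v)"
    and lim: "uniform_limit (cball z0 r) f g F"
    and g: "(g has_derivative Dg) (at z0)"
    and F: "F \<noteq> bot"
  shows "((\<lambda>\<nu>. D \<nu> z0 v) \<longlongrightarrow> Dg v) F"
proof -
  let ?l = "\<lambda>t. z0 + t *s v"
  have bl: "bounded_linear (\<lambda>t. t *s v)"
    using linear_vector_scalar_mult_left linear_conv_bounded_linear by blast
  have l: "(?l has_derivative (\<lambda>t. t *s v)) (at t)" for t
    using has_derivative_add[OF has_derivative_const bounded_linear_imp_has_derivative[OF bl]]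
    by simp
  have "continuous_on UNIV ?l"
    using l by (meson continuous_at_imp_continuous_on has_derivative_continuous)
  then have "open (?l -` ball z0 r)" by (simp add: open_vimage)
  moreover have "0 \<in> ?l -` ball z0 r" using \<open>0 < r\<close> by simp
  ultimately obtain \<rho> where \<rho>: "\<rho> > 0" "cball 0 \<rho> \<subseteq> ?l -` ball z0 r"
    using open_contains_cball by blast
  have in_ball: "?l t \<in> cball z0 r" if "t \<in> cball 0 \<rho>" for t
    using \<rho>(2) that ball_subset_cball by blast
  have "((\<lambda>\<nu>. D \<nu> z0 v $ k) \<longlongrightarrow> Dg v $ k) F" for k
  proof -
    have line: "((\<lambda>t. h (?l t) $ k) has_derivative (\<lambda>s. E (s *s v) $ k)) (at t)"
      if "(h has_derivative E) (at (?l t))" for h :: "complex^'n \<Rightarrow> complex^'m" and E t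
      using bounded_linear.has_derivative[OF bounded_linear_vec_nth
          has_derivative_compose[OF l that]] .
    have ev: "\<forall>\<^sub>F \<nu> in F. continuous_on (cball 0 \<rho>) (\<lambda>t. f \<nu> (?l t) $ k) \<and>
        (\<forall>t\<in>ball 0 \<rho>. ((\<lambda>t. f \<nu> (?l t) $ k) has_field_derivative D \<nu> (?l t) v $ k) (at t))"
      using hol
    proof eventually_elim
      case (elim \<nu>)
      have "((\<lambda>t. f \<nu> (?l t) $ k) has_field_derivative D \<nu> (?l t) v $ k) (at t)"
        if "t \<in> cball 0 \<rho>" for t
      proof -
        have "(\<lambda>s. D \<nu> (?l t) (s *s v) $ k) = (*) (D \<nu> (?l t) v $ k)"
          using elim in_ball[OF that] by (auto simp: mult.commute)
        then show ?thesis
          using line elim in_ball[OF that] unfolding has_field_derivative_def by metis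
      qed
      then show ?case
        by (meson ball_subset_cball continuous_at_imp_continuous_on DERIV_isCont subsetD)
    qed
    have ul: "uniform_limit (cball 0 \<rho>) (\<lambda>\<nu> t. f \<nu> (?l t) $ k) (\<lambda>t. g (?l t) $ k) F"
    proof (rule bounded_linear.uniform_limit[OF bounded_linear_vec_nth])
      show "uniform_limit (cball 0 \<rho>) (\<lambda>\<nu> t. f \<nu> (?l t)) (\<lambda>t. g (?l t)) F"
        using lim in_ball unfolding uniform_limit_iff
        by (smt (verit, best) eventually_mono)
    qed
    obtain g' where g': "\<And>w. w \<in> ball 0 \<rho> \<Longrightarrow>
        ((\<lambda>t. g (?l t) $ k) has_field_derivative g' w) (at w) \<and>
        ((\<lambda>\<nu>. D \<nu> (?l w) v $ k) \<longlongrightarrow> g' w) F"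
      using has_complex_derivative_uniform_limit[OF ev ul F \<open>\<rho> > 0\<close>] by metis
    have "((\<lambda>t. g (?l t) $ k) has_derivative (\<lambda>s. Dg (s *s v) $ k)) (at 0)"
      by (rule line) (use g in simp)
    then have "(*) (g' 0) = (\<lambda>s. Dg (s *s v) $ k)"
      using g'[of 0] \<open>\<rho> > 0\<close> has_derivative_unique
      unfolding has_field_derivative_def by (metis centre_in_ball)
    from fun_cong[OF this, of 1] have "g' 0 = Dg v $ k" by simp
    then show ?thesis using g'[of 0] \<open>\<rho> > 0\<close> by simp
  qed
  then show ?thesis by (rule vec_tendstoI)
qed

section \<open>The compact-open topology\<close>

lemma C0_limit_eventually_maps_into:
  assumes "limitin C0_topology \<psi>s \<psi> F" "continuous_on UNIV \<psi>"
    and "compact K" "open U" "\<psi> ` K \<subseteq> U"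
  shows "\<forall>\<^sub>F \<nu> in F. \<psi>s \<nu> ` K \<subseteq> U"
proof -
  let ?N = "{f. continuous_on UNIV f \<and> f ` K \<subseteq> U}"
  have "openin C0_topology ?N"
    unfolding C0_topology_def using assms(3,4) by (intro topology_generated_by_Basis) blast
  then have "\<forall>\<^sub>F \<nu> in F. \<psi>s \<nu> \<in> ?N"
    using assms unfolding limitin_def by blast
  then show ?thesis by (rule eventually_mono) auto
qed

text \<open>Compact-open convergence is uniform on compact sets: \<open>K\<close> is covered by finitely many compact
  pieces, on each of which the limit stays within \<open>\<epsilon>/2\<close> of one of its values.\<close>

lemma C0_limit_uniform:
  fixes h :: "'e::metric_space \<Rightarrow> 'w::topological_space" and k :: "'w \<Rightarrow> 'b::metric_space"
  assumes lim: "limitin C0_topology \<psi>s \<psi> F" and \<psi>: "continuous_on UNIV \<psi>"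
    and K: "compact K" and h: "continuous_on K h"
    and V: "open V" and k: "continuous_on V k" and sub: "\<psi> ` h ` K \<subseteq> V"
  shows "uniform_limit K (\<lambda>\<nu>. k \<circ> \<psi>s \<nu> \<circ> h) (k \<circ> \<psi> \<circ> h) F"
  unfolding uniform_limit_iff
proof (intro allI impI)
  fix e :: real assume "e > 0"
  define O' where "O' z = V \<inter> k -` ball (k (\<psi> (h z))) (e/2)" for z
  have O_open: "open (O' z)" for z
    unfolding O'_def using k V by (simp add: continuous_open_preimage)
  have \<psi>h: "continuous_on K (\<psi> \<circ> h)"
    using \<psi> h by (meson continuous_on_compose continuous_on_subset subset_UNIV)
  have "\<exists>d>0. \<psi> ` h ` (K \<inter> cball z d) \<subseteq> O' z" if "z \<in> K" for z
  proof -
    have "\<psi> (h z) \<in> O' z" using sub that \<open>e > 0\<close> by (auto simp: O'_def)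
    moreover obtain T where T: "open T" "T \<inter> K = (\<psi> \<circ> h) -` O' z \<inter> K"
      using \<psi>h O_open[of z] unfolding continuous_on_open_invariant by blast
    ultimately have "z \<in> T" using that by auto
    then obtain d where "d > 0" "cball z d \<subseteq> T" using T(1) open_contains_cball by blast
    then show ?thesis using T(2) by (intro exI[of _ d]) auto
  qed
  then obtain d where d: "\<And>z. z \<in> K \<Longrightarrow> d z > 0 \<and> \<psi> ` h ` (K \<inter> cball z (d z)) \<subseteq> O' z"
    by metis
  obtain C where C: "C \<subseteq> K" "finite C" "K \<subseteq> (\<Union>z\<in>C. ball z (d z))"
    by (rule compactE_image[OF K, of K "\<lambda>z. ball z (d z)"]) (use d in force)+
  have "\<forall>\<^sub>F \<nu> in F. \<psi>s \<nu> ` h ` (K \<inter> cball z (d z)) \<subseteq> O' z" if "z \<in> C" for z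
  proof (rule C0_limit_eventually_maps_into[OF lim \<psi> _ O_open])
    show "compact (h ` (K \<inter> cball z (d z)))"
      using K h by (meson closed_cball compact_Int_closed compact_continuous_image
          continuous_on_subset inf_le1)
  qed (use d C that in blast)
  then have "\<forall>\<^sub>F \<nu> in F. \<forall>z\<in>C. \<psi>s \<nu> ` h ` (K \<inter> cball z (d z)) \<subseteq> O' z"
    using C(2) by (simp add: eventually_ball_finite)
  then show "\<forall>\<^sub>F \<nu> in F. \<forall>x\<in>K. dist ((k \<circ> \<psi>s \<nu> \<circ> h) x) ((k \<circ> \<psi> \<circ> h) x) < e"
  proof (rule eventually_mono, intro ballI)
    fix \<nu> x assume *: "\<forall>z\<in>C. \<psi>s \<nu> ` h ` (K \<inter> cball z (d z)) \<subseteq> O' z" and "x \<in> K"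
    then obtain z where z: "z \<in> C" "x \<in> K \<inter> cball z (d z)" using C by force
    then have "\<psi>s \<nu> (h x) \<in> O' z" "\<psi> (h x) \<in> O' z"
      using * d[of z] C(1) by blast+
    then show "dist ((k \<circ> \<psi>s \<nu> \<circ> h) x) ((k \<circ> \<psi> \<circ> h) x) < e"
      unfolding O'_def by (auto intro: dist_triangle_half_r)
  qed
qed

section \<open>Charts and tangent vectors\<close>

context
  fixes A :: "('w::{t2_space, second_countable_topology}, complex^'n) chart set"
  assumes mfd: "complex_manifold A"
begin

lemma chart:
  assumes "c \<in> A"
  shows chart_open_dom: "open (chart_dom c)"
    and chart_continuous: "continuous_on (chart_dom c) (chart_map c)"
    and chart_inv_continuous: "continuous_on (chart_map c ` chart_dom c) (chart_inv c)"
    and chart_inv_map: "p \<in> chart_dom c \<Longrightarrow> chart_inv c (chart_map c p) = p"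
    and chart_open_image: "open V \<Longrightarrow> open (chart_map c ` (chart_dom c \<inter> V))"
proof -
  have "is_chart c" using mfd assms unfolding complex_manifold_def is_atlas_def by blast
  then have o: "open (chart_dom c)" "open (chart_map c ` chart_dom c)"
    and hm: "homeomorphism (chart_dom c) (chart_map c ` chart_dom c) (chart_map c) (chart_inv c)"
    unfolding is_chart_def by blast+
  show "open (chart_dom c)" by (rule o)
  show "continuous_on (chart_dom c) (chart_map c)"
    "continuous_on (chart_map c ` chart_dom c) (chart_inv c)"
    using hm unfolding homeomorphism_def by blast+
  show "chart_inv c (chart_map c p) = p" if "p \<in> chart_dom c"
    using hm that unfolding homeomorphism_def by blast
  show "open (chart_map c ` (chart_dom c \<inter> V))" if "open V"
  proof -
    have "openin (top_of_set (chart_map c ` chart_dom c)) (chart_map c ` (chart_dom c \<inter> V))"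
      by (rule homeomorphism_imp_open_map[OF hm]) (use that in auto)
    then show ?thesis using o(2) openin_open_trans by blast
  qed
qed

lemma charts_atD: "c \<in> charts_at A q \<Longrightarrow> c \<in> A" "c \<in> charts_at A q \<Longrightarrow> q \<in> chart_dom c"
  by (auto simp: charts_at_def)

lemma charts_at_nonempty: "\<exists>c. c \<in> charts_at A q"
proof -
  have "q \<in> (\<Union>c\<in>A. chart_dom c)" using mfd by (simp add: complex_manifold_def is_atlas_def)
  then show ?thesis unfolding charts_at_def by blast
qed

abbreviation transition_deriv where
  "transition_deriv c d q \<equiv> frechet_derivative (transition c d) (at (chart_map c q))"

lemma transition_deriv:
  assumes "c \<in> charts_at A q" "d \<in> charts_at A q"
  shows transition_has_derivative:
      "(transition c d has_derivative transition_deriv c d q) (at (chart_map c q))"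
    and transition_deriv_linear: "linear (transition_deriv c d q)"
    and transition_deriv_complex_linear: "transition_deriv c d q (a *s v) = a *s transition_deriv c d q v"
proof -
  have "chart_map c q \<in> chart_map c ` (chart_dom c \<inter> chart_dom d)"
    using assms charts_atD by blast
  moreover have "holomorphic_map_on (chart_map c ` (chart_dom c \<inter> chart_dom d)) (transition c d)"
    using mfd assms charts_atD unfolding complex_manifold_def by blast
  ultimately obtain D where D: "(transition c d has_derivative D) (at (chart_map c q))"
    "\<And>a v. D (a *s v) = a *s D v"
    unfolding holomorphic_map_on_def by blast
  have "transition_deriv c d q = D" using frechet_derivative_at[OF D(1)] by simp
  then show "(transition c d has_derivative transition_deriv c d q) (at (chart_map c q))"
    "linear (transition_deriv c d q)"
    "transition_deriv c d q (a *s v) = a *s transition_deriv c d q v"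
    using D by (auto simp: has_derivative_linear)
qed

lemma transition_deriv_self:
  assumes "c \<in> charts_at A q"
  shows "transition_deriv c c q = (\<lambda>u. u)"
proof -
  have "(transition c c has_derivative (\<lambda>u. u)) (at (chart_map c q))"
    by (rule has_derivative_transform_within_open[OF has_derivative_ident
          chart_open_image[of c UNIV]])
       (use charts_atD[OF assms] chart_inv_map[OF charts_atD(1)[OF assms]] in \<open>auto simp: transition_def\<close>)
  then show ?thesis using frechet_derivative_at by metis
qed

text \<open>The chain rule behind the chart independence of differentials. For \<open>f\<close> the identity it is
  also the cocycle condition for the transition maps.\<close>

lemma change_of_charts:
  assumes f: "continuous_on UNIV f"
    and c: "c \<in> charts_at A q" "c' \<in> charts_at A q"
    and d: "d \<in> charts_at A (f q)" "d' \<in> charts_at A (f q)"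
    and D: "(chart_map d \<circ> f \<circ> chart_inv c has_derivative D) (at (chart_map c q))"
  shows "(chart_map d' \<circ> f \<circ> chart_inv c' has_derivative
           (\<lambda>u. transition_deriv d d' (f q) (D (transition_deriv c' c q u)))) (at (chart_map c' q))"
proof -
  \<comment> \<open>On the image of this neighborhood of \<open>q\<close> under \<open>c'\<close>, the new coordinate expression is the old
    one composed with both transition maps; elsewhere the compositions have no meaning.\<close>
  let ?V = "chart_dom c \<inter> f -` (chart_dom d \<inter> chart_dom d')"
  have "open ?V"
    using c d f by (intro open_Int open_vimage chart_open_dom charts_atD) auto
  have inv: "chart_inv e (chart_map e p) = p" if "e \<in> {c, c', d, d'}" "p \<in> chart_dom e" for e p
    using chart_inv_map charts_atD c d that by blast
  note cq = charts_atD(2)[OF c(1)] charts_atD(2)[OF c(2)] charts_atD(2)[OF d(1)]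
    charts_atD(2)[OF d(2)]
  have 1: "((chart_map d \<circ> f \<circ> chart_inv c) \<circ> transition c' c has_derivative
      D \<circ> transition_deriv c' c q) (at (chart_map c' q))"
    by (rule diff_chain_at[OF transition_has_derivative[OF c(2,1)]])
       (use D cq in \<open>simp add: transition_def inv\<close>)
  have 2: "(transition d d' \<circ> ((chart_map d \<circ> f \<circ> chart_inv c) \<circ> transition c' c) has_derivative
      transition_deriv d d' (f q) \<circ> (D \<circ> transition_deriv c' c q)) (at (chart_map c' q))"
    by (rule diff_chain_at[OF 1])
       (use transition_has_derivative[OF d] cq in \<open>simp add: transition_def inv\<close>)
  have 3: "(chart_map d' \<circ> f \<circ> chart_inv c' has_derivative
      transition_deriv d d' (f q) \<circ> (D \<circ> transition_deriv c' c q)) (at (chart_map c' q))"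
    by (rule has_derivative_transform_within_open[OF 2
          chart_open_image[OF charts_atD(1)[OF c(2)] \<open>open ?V\<close>]])
       (use cq in \<open>auto simp: transition_def inv\<close>)
  then show ?thesis by (simp add: o_def)
qed

lemma transition_deriv_trans:
  assumes c: "c \<in> charts_at A q" and d: "d \<in> charts_at A q" and e: "e \<in> charts_at A q"
  shows "transition_deriv d e q (transition_deriv c d q u) = transition_deriv c e q u"
proof -
  have "(chart_map d \<circ> (\<lambda>x. x) \<circ> chart_inv c has_derivative transition_deriv c d q)
      (at (chart_map c q))"
    using transition_has_derivative[OF c d] unfolding transition_def o_def .
  from change_of_charts[where f = "\<lambda>x. x", OF continuous_on_id c c d e this]
  have "(chart_map e \<circ> (\<lambda>x. x) \<circ> chart_inv c has_derivative
      (\<lambda>u. transition_deriv d e q (transition_deriv c d q u))) (at (chart_map c q))"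
    unfolding transition_deriv_self[OF c] .
  then have "(transition c e has_derivative
      (\<lambda>u. transition_deriv d e q (transition_deriv c d q u))) (at (chart_map c q))"
    unfolding transition_def o_def .
  from fun_cong[OF frechet_derivative_at[OF this], of u] show ?thesis .
qed

lemma tangent_of_in_tangent_space:
  "c \<in> charts_at A q \<Longrightarrow> tangent_of A q c u \<in> tangent_space A q"
  unfolding tangent_space_def mem_Collect_eq
  by (intro conjI ballI allI impI)
     (simp_all only: tangent_of_def if_True if_False transition_deriv_trans)

lemma tangent_of_at_chart: "c \<in> charts_at A q \<Longrightarrow> tangent_of A q c u c = u"
  unfolding tangent_of_def by (simp only: if_True transition_deriv_self)

lemma tangent_eq_tangent_of:
  assumes "c \<in> charts_at A q" "X \<in> tangent_space A q"
  shows "X = tangent_of A q c (X c)"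
proof (rule ext)
  fix d show "X d = tangent_of A q c (X c) d"
  proof (cases "d \<in> charts_at A q")
    case True
    then have "X d = transition_deriv c d q (X c)"
      using assms unfolding tangent_space_def by blast
    then show ?thesis using True by (simp only: tangent_of_def if_True)
  next
    case False
    then have "X d = 0" using assms(2) unfolding tangent_space_def by blast
    then show ?thesis using False by (simp only: tangent_of_def if_False)
  qed
qed


lemma tangent_of_linear:
  assumes "c \<in> charts_at A q"
  shows "tangent_of A q c (u + v) = (\<lambda>d. tangent_of A q c u d + tangent_of A q c v d)"
    and "tangent_of A q c (r *\<^sub>R u) = (\<lambda>d. r *\<^sub>R tangent_of A q c u d)"
    and "tangent_of A q c (\<i> *s u) = complex_structure (tangent_of A q c u)"
proof -
  show "tangent_of A q c (u + v) = (\<lambda>d. tangent_of A q c u d + tangent_of A q c v d)"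
    by (rule ext) (simp add: tangent_of_def linear_add[OF transition_deriv_linear[OF assms]])
  show "tangent_of A q c (r *\<^sub>R u) = (\<lambda>d. r *\<^sub>R tangent_of A q c u d)"
    by (rule ext) (simp add: tangent_of_def linear_cmul[OF transition_deriv_linear[OF assms]])
  show "tangent_of A q c (\<i> *s u) = complex_structure (tangent_of A q c u)"
    unfolding complex_structure_def
    by (rule ext) (simp add: tangent_of_def transition_deriv_complex_linear[OF assms])
qed

text \<open>The differential is defined through an arbitrarily chosen chart at \<open>q\<close>; the chain rule
  allows any other one.\<close>

lemma differential_tangent_of:
  assumes f: "continuous_on UNIV f"
    and c: "c \<in> charts_at A q" and d: "d \<in> charts_at A (f q)"
    and D: "(chart_map d \<circ> f \<circ> chart_inv c has_derivative D) (at (chart_map c q))"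
  shows "differential A f q (tangent_of A q c u) = tangent_of A (f q) d (D u)"
proof -
  define c0 where "c0 = (SOME c. c \<in> charts_at A q)"
  have c0: "c0 \<in> charts_at A q" unfolding c0_def by (rule someI_ex[OF charts_at_nonempty])
  have u: "transition_deriv c0 c q (tangent_of A q c u c0) = u"
    using c0 by (simp only: tangent_of_def if_True transition_deriv_trans[OF c c0 c]
        transition_deriv_self[OF c])
  have "frechet_derivative (chart_map e \<circ> f \<circ> chart_inv c0) (at (chart_map c0 q))
          (tangent_of A q c u c0) = transition_deriv d e (f q) (D u)"
    if "e \<in> charts_at A (f q)" for e
    unfolding frechet_derivative_at[OF change_of_charts[OF f c c0 d that D], symmetric] u ..
  then show ?thesis
    unfolding differential_def Let_def c0_def[symmetric] tangent_of_def[of A "f q"]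
    by (intro ext) simp
qed

lemma smooth_map_has_derivative:
  assumes "smooth_map A f" "c \<in> charts_at A q" "d \<in> charts_at A (f q)"
  shows "(chart_map d \<circ> f \<circ> chart_inv c has_derivative
    frechet_derivative (chart_map d \<circ> f \<circ> chart_inv c) (at (chart_map c q))) (at (chart_map c q))"
proof -
  have "Ck_on (Suc 0) (chart_map c ` (chart_dom c \<inter> f -` chart_dom d))
      (chart_map d \<circ> f \<circ> chart_inv c)"
    using assms charts_atD(1) unfolding smooth_map_def smooth_on_def by blast
  moreover have "chart_map c q \<in> chart_map c ` (chart_dom c \<inter> f -` chart_dom d)"
    using assms charts_atD(2) by blast
  ultimately show ?thesis
    unfolding Ck_on.simps frechet_derivative_works[symmetric] by blast
qed

section \<open>Coordinate expressions of polysymplectic forms\<close>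

lemma poly_pullback_tangent_of:
  fixes \<Omega> :: "('w, complex^'n, real^2) form2"
  assumes "continuous_on UNIV f"
    and c: "c \<in> charts_at A q" and d: "d \<in> charts_at A (f q)"
    and "(chart_map d \<circ> f \<circ> chart_inv c has_derivative D) (at (chart_map c q))"
  shows "poly_pullback A f \<Omega> q (tangent_of A q c u) (tangent_of A q c v) =
         local_form A \<Omega> d (chart_map d (f q)) (D u) (D v)"
  using differential_tangent_of[OF assms] tangent_of_in_tangent_space[OF c]
    chart_inv_map[OF charts_atD(1,2)[OF d]]
  by (simp add: poly_pullback_def pullback_def form_component_def local_form_def vec_eq_iff)

context
  fixes \<Omega> :: "('w, complex^'n, real^2) form2"
  assumes crp: "complex_regularized_polysymplectic A \<Omega>"
begin

lemma two_form_\<Omega>: "two_form A \<Omega>"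
  using crp by (simp add: complex_regularized_polysymplectic_def polysymplectic_def)

lemma local_form_at:
  assumes "c \<in> charts_at A q"
  shows "local_form A \<Omega> c (chart_map c q) u v = \<Omega> q (tangent_of A q c u) (tangent_of A q c v)"
  using chart_inv_map[OF charts_atD(1,2)[OF assms]] by (simp add: local_form_def)

lemma local_form_antisym:
  assumes "c \<in> charts_at A q"
  shows "local_form A \<Omega> c (chart_map c q) v u = - local_form A \<Omega> c (chart_map c q) u v"
  using two_form_\<Omega> tangent_of_in_tangent_space[OF assms]
  unfolding local_form_at[OF assms] two_form_def by blast

lemma local_form_bilinear:
  assumes c: "c \<in> charts_at A q"
  shows "bilinear (local_form A \<Omega> c (chart_map c q))"
proof -
  let ?B = "local_form A \<Omega> c (chart_map c q)"
  have lin: "linear (\<lambda>u. ?B u v)" for v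
    unfolding local_form_at[OF c]
  proof (rule linearI)
    fix u w and r :: real
    show "\<Omega> q (tangent_of A q c (u + w)) (tangent_of A q c v) =
        \<Omega> q (tangent_of A q c u) (tangent_of A q c v) +
        \<Omega> q (tangent_of A q c w) (tangent_of A q c v)"
      unfolding tangent_of_linear(1)[OF c]
      using two_form_\<Omega> tangent_of_in_tangent_space[OF c] unfolding two_form_def by blast
    show "\<Omega> q (tangent_of A q c (r *\<^sub>R u)) (tangent_of A q c v) =
        r *\<^sub>R \<Omega> q (tangent_of A q c u) (tangent_of A q c v)"
      unfolding tangent_of_linear(2)[OF c]
      using two_form_\<Omega> tangent_of_in_tangent_space[OF c] unfolding two_form_def by blast
  qed
  have "?B u = (\<lambda>v. - ?B v u)" for u using local_form_antisym[OF c] by blast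
  then have "linear (?B u)" for u by (metis linear_compose_neg lin)
  then show ?thesis using lin by (simp add: bilinear_def)
qed

lemma local_form_regularized:
  assumes c: "c \<in> charts_at A q"
  shows "local_form A \<Omega> c (chart_map c q) u v $ 2 =
         - local_form A \<Omega> c (chart_map c q) u (\<i> *s v) $ 1"
  using crp tangent_of_in_tangent_space[OF c]
  unfolding local_form_at[OF c] tangent_of_linear(3)[OF c]
    complex_regularized_polysymplectic_def form_component_def by blast

lemma local_form_nondegenerate:
  assumes c: "c \<in> charts_at A q" and "\<And>v. local_form A \<Omega> c (chart_map c q) u v = 0"
  shows "u = 0"
proof -
  have "\<Omega> q (tangent_of A q c u) Y = 0" if "Y \<in> tangent_space A q" for Y
    using assms(2)[of "Y c"]
    unfolding local_form_at[OF c] tangent_eq_tangent_of[OF c that, symmetric] .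
  then have "tangent_of A q c u = (\<lambda>c. 0)"
    using crp tangent_of_in_tangent_space[OF c]
    unfolding complex_regularized_polysymplectic_def polysymplectic_def by blast
  then show ?thesis using tangent_of_at_chart[OF c, of u] by simp
qed

text \<open>Joint continuity in the base point and both vectors: by bilinearity only the finitely many
  coefficients on basis vectors matter, and those are smooth functions of the base point.\<close>

lemma local_form_tendsto:
  assumes d: "d \<in> charts_at A q" and "\<forall>\<^sub>F \<nu> in F. d \<in> charts_at A (qs \<nu>)"
    and q: "((\<lambda>\<nu>. chart_map d (qs \<nu>)) \<longlongrightarrow> chart_map d q) F"
    and u: "(us \<longlongrightarrow> u) F" and v: "(vs \<longlongrightarrow> v) F"
  shows "((\<lambda>\<nu>. local_form A \<Omega> d (chart_map d (qs \<nu>)) (us \<nu>) (vs \<nu>)) \<longlongrightarrow>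
          local_form A \<Omega> d (chart_map d q) u v) F"
proof -
  let ?S = "\<lambda>z u v. \<Sum>i\<in>Basis. \<Sum>j\<in>Basis. (u \<bullet> i) *\<^sub>R (v \<bullet> j) *\<^sub>R local_form A \<Omega> d z i j"
  have expand: "local_form A \<Omega> d (chart_map d q) u v = ?S (chart_map d q) u v"
    if "d \<in> charts_at A q" for q u v
  proof -
    let ?B = "local_form A \<Omega> d (chart_map d q)"
    have lin: "linear (\<lambda>u. ?B u w)" "linear (?B w)" for w
      using local_form_bilinear[OF that] by (auto simp: bilinear_def)
    have "?B u v = ?B (\<Sum>i\<in>Basis. (u \<bullet> i) *\<^sub>R i) (\<Sum>j\<in>Basis. (v \<bullet> j) *\<^sub>R j)"
      by (simp add: euclidean_representation)
    also have "\<dots> = (\<Sum>i\<in>Basis. (u \<bullet> i) *\<^sub>R ?B i (\<Sum>j\<in>Basis. (v \<bullet> j) *\<^sub>R j))"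
      by (simp add: linear_sum[OF lin(1)] linear_cmul[OF lin(1)])
    also have "\<dots> = ?S (chart_map d q) u v"
      by (simp only: linear_sum[OF lin(2)] linear_cmul[OF lin(2)] scaleR_sum_right)
    finally show ?thesis .
  qed
  have coeff: "((\<lambda>\<nu>. local_form A \<Omega> d (chart_map d (qs \<nu>)) i j) \<longlongrightarrow>
      local_form A \<Omega> d (chart_map d q) i j) F" for i j
  proof -
    have "Ck_on 0 (chart_map d ` chart_dom d) (\<lambda>z. local_form A \<Omega> d z i j)"
      using two_form_\<Omega> charts_atD(1)[OF d] unfolding two_form_def smooth_on_def by blast
    then have cont: "continuous_on (chart_map d ` chart_dom d) (\<lambda>z. local_form A \<Omega> d z i j)"
      by simp
    have "\<forall>\<^sub>F \<nu> in F. chart_map d (qs \<nu>) \<in> chart_map d ` chart_dom d"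
      using assms(2) by (rule eventually_mono) (rule imageI, erule charts_atD(2))
    from continuous_on_tendsto_compose[OF cont q imageI[OF charts_atD(2)[OF d]] this]
    show ?thesis .
  qed
  have "((\<lambda>\<nu>. ?S (chart_map d (qs \<nu>)) (us \<nu>) (vs \<nu>)) \<longlongrightarrow> ?S (chart_map d q) u v) F"
    by (intro tendsto_sum tendsto_scaleR tendsto_inner tendsto_const u v coeff)
  then show ?thesis
  proof (subst expand[OF d], rule Lim_transform_eventually)
    show "\<forall>\<^sub>F \<nu> in F. ?S (chart_map d (qs \<nu>)) (us \<nu>) (vs \<nu>) =
        local_form A \<Omega> d (chart_map d (qs \<nu>)) (us \<nu>) (vs \<nu>)"
      using assms(2) by (rule eventually_mono) (rule expand[symmetric])
  qed
qed

text \<open>In coordinates, preserving \<open>\<Omega>\<close> relates the values of the form at \<open>q\<close> and at \<open>f q\<close>; both are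
  forms of the kind treated by the linear algebra above, each with its own coefficients.\<close>

lemma preserving_map_complex_linear:
  assumes f: "continuous_on UNIV f" and pres: "poly_pullback A f \<Omega> = \<Omega>"
    and c: "c \<in> charts_at A q" and d: "d \<in> charts_at A (f q)"
    and D: "(chart_map d \<circ> f \<circ> chart_inv c has_derivative D) (at (chart_map c q))"
  shows "D (a *s v) = a *s D v"
proof (rule preserves_polysymplectic_imp_complex_linear
    [where B = "local_form A \<Omega> c (chart_map c q)" and B' = "local_form A \<Omega> d (chart_map d (f q))"])
  show "local_form A \<Omega> d (chart_map d (f q)) (D u) (D v) = local_form A \<Omega> c (chart_map c q) u v"
    for u v
    using poly_pullback_tangent_of[OF f c d D, of \<Omega> u v, symmetric]
    unfolding pres local_form_at[OF c] .
qed (rule local_form_bilinear[OF d] local_form_antisym[OF c] local_form_antisym[OF d]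
    local_form_regularized[OF c] local_form_regularized[OF d] has_derivative_linear[OF D]
    local_form_nondegenerate[OF c] local_form_nondegenerate[OF d]; assumption)+

end

end

section \<open>Limits of maps preserving a complex-regularized form\<close>

theorem corollary6p2:
  fixes A :: "('w::{t2_space, second_countable_topology}, complex^'n) chart set"
    and \<Omega> :: "('w, complex^'n, real^2) form2"
    and \<psi>s :: "nat \<Rightarrow> 'w \<Rightarrow> 'w"
    and \<psi> :: "'w \<Rightarrow> 'w"
  assumes "complex_regularized_polysymplectic A \<Omega>"
    and "\<And>\<nu>. diffeomorphism A (\<psi>s \<nu>)"
    and "\<And>\<nu>. poly_pullback A (\<psi>s \<nu>) \<Omega> = \<Omega>"
    and "diffeomorphism A \<psi>"
    and "limitin C0_topology \<psi>s \<psi> sequentially"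
  shows "poly_pullback A \<psi> \<Omega> = \<Omega>"
proof (intro ext)
  fix p X Y
  have mfd: "complex_manifold A"
    using assms(1) by (simp add: complex_regularized_polysymplectic_def)
  note chart = chart[OF mfd]
  have smooth: "smooth_map A (\<psi>s \<nu>)" "smooth_map A \<psi>" for \<nu>
    using assms(2,4) by (auto simp: diffeomorphism_def)
  then have cont: "continuous_on UNIV (\<psi>s \<nu>)" "continuous_on UNIV \<psi>" for \<nu>
    by (auto simp: smooth_map_def)
  show "poly_pullback A \<psi> \<Omega> p X Y = \<Omega> p X Y"
  proof (cases "X \<in> tangent_space A p \<and> Y \<in> tangent_space A p")
    case False
    then have "\<Omega> p X Y = 0"
      using two_form_\<Omega>[OF mfd assms(1)] unfolding two_form_def by blast
    then show ?thesis
      unfolding poly_pullback_def pullback_def if_not_P[OF False] by (simp add: vec_eq_iff)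
  next
    case True
    obtain c where c: "c \<in> charts_at A p" using charts_at_nonempty[OF mfd] by blast
    obtain d where d: "d \<in> charts_at A (\<psi> p)" using charts_at_nonempty[OF mfd] by blast
    note cA = charts_atD[OF mfd c] and dA = charts_atD[OF mfd d]
    obtain u v where XY: "X = tangent_of A p c u" "Y = tangent_of A p c v"
      using that[OF tangent_eq_tangent_of[OF mfd c conjunct1[OF True]]
          tangent_eq_tangent_of[OF mfd c conjunct2[OF True]]] .
    let ?z = "chart_map c p"
    let ?rep = "\<lambda>f. chart_map d \<circ> f \<circ> chart_inv c"
    let ?D = "\<lambda>f. frechet_derivative (?rep f)"
    \<comment> \<open>A closed ball around \<open>p\<close> in coordinates that \<open>\<psi>\<close>, hence almost all \<open>\<psi>s \<nu>\<close>, maps into the domain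
      of \<open>d\<close>.\<close>
    have "open (chart_map c ` (chart_dom c \<inter> \<psi> -` chart_dom d))"
      using chart(5)[OF cA(1)] chart(1)[OF dA(1)] cont(2) by (simp add: open_vimage)
    then obtain r where r: "r > 0" "cball ?z r \<subseteq> chart_map c ` (chart_dom c \<inter> \<psi> -` chart_dom d)"
      using open_contains_cball[of "chart_map c ` (chart_dom c \<inter> \<psi> -` chart_dom d)"] cA(2) dA(2)
      by blast
    have inv: "continuous_on (cball ?z r) (chart_inv c)"
      using chart(3)[OF cA(1)] r(2) by (meson Int_lower1 continuous_on_subset image_mono order_trans)
    have sub: "\<psi> ` chart_inv c ` cball ?z r \<subseteq> chart_dom d"
      using r(2) chart(4)[OF cA(1)] by fastforce
    have ev: "\<forall>\<^sub>F \<nu> in sequentially. \<psi>s \<nu> ` chart_inv c ` cball ?z r \<subseteq> chart_dom d"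
      using C0_limit_eventually_maps_into[OF assms(5) cont(2) _ chart(1)[OF dA(1)] sub] inv
      by (simp add: compact_continuous_image)
    have p: "p \<in> chart_inv c ` cball ?z r"
      using chart(4)[OF cA] r(1) by (metis centre_in_cball image_eqI less_imp_le)
    have ulim: "uniform_limit (cball ?z r) (\<lambda>\<nu>. ?rep (\<psi>s \<nu>)) (?rep \<psi>) sequentially"
      by (rule C0_limit_uniform[OF assms(5) cont(2) _ inv chart(1,2)[OF dA(1)] sub]) simp
    have hol: "\<forall>\<^sub>F \<nu> in sequentially. \<forall>z\<in>cball ?z r.
        (?rep (\<psi>s \<nu>) has_derivative ?D (\<psi>s \<nu>) (at z)) (at z) \<and>
        (\<forall>a w. ?D (\<psi>s \<nu>) (at z) (a *s w) = a *s ?D (\<psi>s \<nu>) (at z) w)"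
      using ev
    proof (rule eventually_mono, intro ballI)
      fix \<nu> z
      assume *: "\<psi>s \<nu> ` chart_inv c ` cball ?z r \<subseteq> chart_dom d" and z: "z \<in> cball ?z r"
      then obtain q where q: "q \<in> chart_dom c" "z = chart_map c q" using r(2) by blast
      then have cq: "c \<in> charts_at A q" using cA(1) by (simp add: charts_at_def)
      have dq: "d \<in> charts_at A (\<psi>s \<nu> q)"
      proof -
        have "q \<in> chart_inv c ` cball ?z r"
          using z q chart(4)[OF cA(1) q(1)] by (metis imageI)
        then show ?thesis using * dA(1) by (auto simp: charts_at_def)
      qed
      show "(?rep (\<psi>s \<nu>) has_derivative ?D (\<psi>s \<nu>) (at z)) (at z) \<and>
          (\<forall>a w. ?D (\<psi>s \<nu>) (at z) (a *s w) = a *s ?D (\<psi>s \<nu>) (at z) w)"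
        using smooth_map_has_derivative[OF mfd smooth(1) cq dq]
          preserving_map_complex_linear[OF mfd assms(1) cont(1) assms(3) cq dq]
        unfolding q(2) by blast
    qed
    note D = smooth_map_has_derivative[OF mfd smooth(2) c d]
    have Dlim: "(\<lambda>\<nu>. ?D (\<psi>s \<nu>) (at ?z) w) \<longlonglongrightarrow> ?D \<psi> (at ?z) w" for w
      by (rule holomorphic_limit_derivative[OF r(1) hol ulim D]) simp
    have ev_d: "\<forall>\<^sub>F \<nu> in sequentially. d \<in> charts_at A (\<psi>s \<nu> p)"
      using ev by (rule eventually_mono) (use p dA(1) in \<open>auto simp: charts_at_def\<close>)
    have "(\<lambda>\<nu>. ?rep (\<psi>s \<nu>) ?z) \<longlonglongrightarrow> ?rep \<psi> ?z"
      by (rule tendsto_uniform_limitI[OF ulim]) (use r(1) in simp)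
    then have plim: "(\<lambda>\<nu>. chart_map d (\<psi>s \<nu> p)) \<longlonglongrightarrow> chart_map d (\<psi> p)"
      by (simp add: chart(4)[OF cA])
    have "(\<lambda>\<nu>. local_form A \<Omega> d (chart_map d (\<psi>s \<nu> p)) (?D (\<psi>s \<nu>) (at ?z) u) (?D (\<psi>s \<nu>) (at ?z) v))
        \<longlonglongrightarrow> local_form A \<Omega> d (chart_map d (\<psi> p)) (?D \<psi> (at ?z) u) (?D \<psi> (at ?z) v)"
      by (rule local_form_tendsto[OF mfd assms(1) d ev_d plim Dlim Dlim])
    moreover have "\<forall>\<^sub>F \<nu> in sequentially. local_form A \<Omega> d (chart_map d (\<psi>s \<nu> p))
        (?D (\<psi>s \<nu>) (at ?z) u) (?D (\<psi>s \<nu>) (at ?z) v) = \<Omega> p X Y"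
      using ev_d
    proof (rule eventually_mono)
      fix \<nu> assume d\<nu>: "d \<in> charts_at A (\<psi>s \<nu> p)"
      show "local_form A \<Omega> d (chart_map d (\<psi>s \<nu> p))
        (?D (\<psi>s \<nu>) (at ?z) u) (?D (\<psi>s \<nu>) (at ?z) v) = \<Omega> p X Y"
        using poly_pullback_tangent_of[OF mfd cont(1) c d\<nu>
            smooth_map_has_derivative[OF mfd smooth(1) c d\<nu>], of \<Omega> u v, symmetric]
        unfolding assms(3) XY .
    qed
    ultimately have "(\<lambda>\<nu>. \<Omega> p X Y) \<longlonglongrightarrow>
        local_form A \<Omega> d (chart_map d (\<psi> p)) (?D \<psi> (at ?z) u) (?D \<psi> (at ?z) v)"
      by (rule Lim_transform_eventually)
    from LIMSEQ_unique[OF tendsto_const this]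
    have "\<Omega> p X Y = local_form A \<Omega> d (chart_map d (\<psi> p)) (?D \<psi> (at ?z) u) (?D \<psi> (at ?z) v)" .
    also have "\<dots> = poly_pullback A \<psi> \<Omega> p X Y"
      unfolding XY by (rule poly_pullback_tangent_of[OF mfd cont(2) c d D, symmetric])
    finally show ?thesis by (rule sym)
  qed
qed

end
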